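(* Let $n$ be a power of a prime $p$, $q=n^2$, and $K$ an algebraic closure of $\mathbb{F}_q$. Let $\mathcal H_n$ be the Hermitian curve $Y^nZ+YZ^n-X^{n+1}=0$ and let $\mathrm{PGU}(3,n)$ be the subgroup of $\mathrm{PGL}(3,q)$ leaving $\mathcal H_n$ invariant, acting on $\mathrm{PG}(2,K)$. Then $d(\mathrm{PGU}(3,n))=n+1$, $\varepsilon(\mathrm{PGU}(3,n))=qn-n$, and $\mathcal H_n$ is the only $\mathrm{PGU}(3,n)$-invariant irreducible plane curve of degree $n+1$.
   Context: Plane curves are over $K$; irreducible means irreducible over $K$; $G$-invariant means mapped onto itself by every element of $G$. $d(G)$ is the smallest degree of a $G$-invariant irreducible plane curve other than a line; $\varepsilon(G)=d'(G)-d(G)$ where $d'(G)$ is the smallest degree larger than $d(G)$ of a $G$-invariant irreducible plane curve. *)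

theory Defs
  imports "HOL-Analysis.Analysis" "HOL-Computational_Algebra.Polynomial"
begin

text \<open>Homogeneous polynomials in X, Y, Z over a field 'k are represented as
  elements of 'k poly poly poly = K[X][Y][Z]: the outer variable is Z, the
  middle one Y, the innermost one X.\<close>

type_synonym 'k poly3 = "'k poly poly poly"

definition C3 :: "'k::comm_ring_1 \<Rightarrow> 'k poly3" where
  "C3 c = [:[:[:c:]:]:]"

definition X3 :: "'k::comm_ring_1 poly3" where "X3 = [:[:[:0, 1:]:]:]"
definition Y3 :: "'k::comm_ring_1 poly3" where "Y3 = [:[:0, 1:]:]"
definition Z3 :: "'k::comm_ring_1 poly3" where "Z3 = [:0, 1:]"

definition coeff3 :: "'k::comm_ring_1 poly3 \<Rightarrow> nat \<Rightarrow> nat \<Rightarrow> nat \<Rightarrow> 'k" where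
  "coeff3 F i j k = coeff (coeff (coeff F k) j) i"

definition homogeneous3 :: "nat \<Rightarrow> 'k::comm_ring_1 poly3 \<Rightarrow> bool" where
  "homogeneous3 d F \<longleftrightarrow> (\<forall>i j k. coeff3 F i j k \<noteq> 0 \<longrightarrow> i + j + k = d)"

definition lin3 :: "'k::comm_ring_1 ^3^3 \<Rightarrow> 3 \<Rightarrow> 'k poly3" where
  "lin3 A i = C3 (A$i$1) * X3 + C3 (A$i$2) * Y3 + C3 (A$i$3) * Z3"

definition subst3 :: "'k::comm_ring_1 poly3 \<Rightarrow> 'k ^3^3 \<Rightarrow> 'k poly3" where
  "subst3 F A =
     (\<Sum>k\<le>degree F. \<Sum>j\<le>degree (coeff F k). \<Sum>i\<le>degree (coeff (coeff F k) j).
        C3 (coeff3 F i j k) * lin3 A 1 ^ i * lin3 A 2 ^ j * lin3 A 3 ^ k)"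

definition invariant3 :: "('k::field ^3^3) set \<Rightarrow> 'k poly3 \<Rightarrow> bool" where
  "invariant3 G F \<longleftrightarrow> (\<forall>A\<in>G. \<exists>c. c \<noteq> 0 \<and> subst3 F A = C3 c * F)"

definition inv_irr_curve_deg :: "('k::field ^3^3) set \<Rightarrow> nat \<Rightarrow> 'k poly3 \<Rightarrow> bool" where
  "inv_irr_curve_deg G d F \<longleftrightarrow>
     F \<noteq> 0 \<and> homogeneous3 d F \<and> irreducible F \<and> invariant3 G F"

definition d_inv :: "('k::field ^3^3) set \<Rightarrow> nat" where
  "d_inv G = (LEAST d. 2 \<le> d \<and> (\<exists>F. inv_irr_curve_deg G d F))"

definition d'_inv :: "('k::field ^3^3) set \<Rightarrow> nat" where
  "d'_inv G = (LEAST d. d_inv G < d \<and> (\<exists>F. inv_irr_curve_deg G d F))"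

definition eps_inv :: "('k::field ^3^3) set \<Rightarrow> nat" where
  "eps_inv G = d'_inv G - d_inv G"

definition hermitian :: "nat \<Rightarrow> 'k::comm_ring_1 poly3" where
  "hermitian n = Y3 ^ n * Z3 + Y3 * Z3 ^ n - X3 ^ (n + 1)"

text \<open>PGU(3,n): matrices of PGL(3,q) (entries in F_q = {x. x^q = x}, q = n^2)
  leaving the Hermitian curve invariant. Scalar multiples act identically,
  so working with matrices instead of classes is harmless.\<close>
definition PGU3 :: "nat \<Rightarrow> ('k::field ^3^3) set" where
  "PGU3 n = {A. invertible A \<and> (\<forall>i j. (A$i$j) ^ (n^2) = A$i$j)
               \<and> (\<exists>c. c \<noteq> 0 \<and> subst3 (hermitian n) A = C3 c * hermitian n)}"

end

theory Submission
  imports Defs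
begin

text \<open>
  Write \<open>H\<close> for the Hermitian form. For \<open>b\<close> in \<open>F_q\<close> and \<open>c + c^n = b^(n+1)\<close> the unipotent
  unitary maps \<open>u(b,c): (x, y, z) \<mapsto> (x + bz, y + b^n x + cz, z)\<close> and their mirror images
  \<open>l(b,c)\<close> under \<open>y \<leftrightarrow> z\<close> lie in \<open>PGU(3,n)\<close> and have \<open>p\<close>-power order, so they fix every semi-invariant
  \<open>F\<close>. Let \<open>F\<close> be such a form of degree \<open>d \<le> n^3\<close>. Restricted to the tangent line \<open>Z = 0\<close> it is invariant
  under \<open>Y \<mapsto> Y + aX\<close> for all \<open>a\<close> in \<open>F_q\<close>; if \<open>F(1,Y,0)\<close> were not constant, then \<open>F(1,Y,0) - F(1,0,0)\<close>
  would vanish to the same order \<open>s\<close> at all \<open>q\<close> points of \<open>F_q\<close>, whence \<open>1 \<le> s < n\<close>, while \<open>u(0,c)\<close>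
  forces the coefficients of \<open>X^(d-i) Y^i\<close> with \<open>1 \<le> i < n\<close> to vanish. So \<open>F(X,Y,0) = a X^d\<close>, and the
  action of the \<open>l(b,c)\<close> on this line gives \<open>n + 1 | d\<close> unless \<open>a = 0\<close>. Subtracting a multiple of a power
  of \<open>H\<close> leaves an invariant form divisible by \<open>Z\<close>, hence by all \<open>n^3 + 1\<close> tangents at rational points,
  so it is zero: \<open>F\<close> is a multiple of a power of \<open>H\<close>.

  In degree \<open>n^3 + 1\<close> the Hermitian form of parameter \<open>n^3\<close> is invariant, because the \<open>n^3\<close>-th and
  the \<open>n\<close>-th power agree on \<open>F_q\<close>.
\<close>

section \<open>Ternary forms as polynomial functions\<close>

text \<open>Polynomial identities are reduced to identities of values. \<open>Z\<close> is the
  outermost variable, so its value enters as a constant of \<open>K[X][Y]\<close> and is substituted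
  first.\<close>

definition ev3 :: "'k::comm_ring_1 poly3 \<Rightarrow> 'k \<Rightarrow> 'k \<Rightarrow> 'k \<Rightarrow> 'k" where
  "ev3 F x y z = poly (poly (poly F [:[:z:]:]) [:y:]) x"

lemma ev3_ring_simps [simp]:
  "ev3 0 x y z = 0" "ev3 1 x y z = 1"
  "ev3 (F + G) x y z = ev3 F x y z + ev3 G x y z"
  "ev3 (F - G) x y z = ev3 F x y z - ev3 G x y z"
  "ev3 (F * G) x y z = ev3 F x y z * ev3 G x y z"
  "ev3 (F ^ m) x y z = ev3 F x y z ^ m"
  "ev3 (C3 c) x y z = c" "ev3 X3 x y z = x" "ev3 Y3 x y z = y" "ev3 Z3 x y z = z"
  by (simp_all add: ev3_def poly_power C3_def X3_def Y3_def Z3_def)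

lemma ev3_sum [simp]: "ev3 (sum F S) x y z = (\<Sum>i\<in>S. ev3 (F i) x y z)"
  by (simp add: ev3_def poly_sum)

lemma ev3_altdef:
  "ev3 F x y z = (\<Sum>k\<le>degree F. \<Sum>j\<le>degree (coeff F k).
     \<Sum>i\<le>degree (coeff (coeff F k) j). coeff3 F i j k * x ^ i * y ^ j * z ^ k)"
proof -
  have "[:[:z:]:] ^ k = [:[:z ^ k:]:]" "[:y:] ^ k = [:y ^ k:]" for k
    by (induction k) (simp_all add: one_pCons)
  then show ?thesis
    unfolding ev3_def coeff3_def
    by (simp add: poly_altdef[of F] poly_altdef[of "coeff F _"] poly_altdef[of "coeff (coeff F _) _"]
        poly_sum sum_distrib_right sum_distrib_left ac_simps)
qed

lemma ev3_lin3:
  "ev3 (lin3 A i) x y z = A $ i $ 1 * x + A $ i $ 2 * y + A $ i $ 3 * z"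
  by (simp add: lin3_def)

lemma ev3_subst3:
  "ev3 (subst3 F A) x y z =
     ev3 F (ev3 (lin3 A 1) x y z) (ev3 (lin3 A 2) x y z) (ev3 (lin3 A 3) x y z)"
  by (simp add: subst3_def ev3_altdef[of F])

lemma ev3_hermitian: "ev3 (hermitian n) x y z = y ^ n * z + y * z ^ n - x ^ (n + 1)"
  by (simp add: hermitian_def)

lemma poly_eq_0_if_infinite_roots:
  fixes p :: "'a::idom poly"
  assumes "infinite S" "\<And>x. x \<in> S \<Longrightarrow> poly p x = 0"
  shows "p = 0"
proof (rule ccontr)
  assume "p \<noteq> 0"
  then have "finite {x. poly p x = 0}" by (rule poly_roots_finite)
  moreover have "S \<subseteq> {x. poly p x = 0}" using assms(2) by auto
  ultimately show False using assms(1) finite_subset by blast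
qed

text \<open>Peels off one variable at a time: constants form an infinite subset of
  \<open>K[X]\<close> and of \<open>K[X][Y]\<close>, and a nonzero polynomial over a domain has
  finitely many roots.\<close>

lemma ev3_eq_0_imp_0:
  fixes F :: "'k::field poly3"
  assumes "infinite (UNIV :: 'k set)" "\<And>x y z. ev3 F x y z = 0"
  shows "F = 0"
proof -
  have inf: "infinite (range (\<lambda>y::'k. [:y:]))" "infinite (range (\<lambda>z::'k. [:[:z:]:]))"
    using assms(1) by (auto simp: finite_image_iff inj_on_def)
  have "poly (poly F [:[:z:]:]) [:y:] = 0" for y z
    using assms by (intro poly_eq_0_if_infinite_roots[of UNIV]) (auto simp: ev3_def)
  then have "poly F [:[:z:]:] = 0" for z
    by (intro poly_eq_0_if_infinite_roots[OF inf(1)]) auto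
  then show ?thesis
    by (intro poly_eq_0_if_infinite_roots[OF inf(2)]) auto
qed

lemma ev3_eqI:
  fixes F :: "'k::field poly3"
  assumes "infinite (UNIV :: 'k set)" "\<And>x y z. ev3 F x y z = ev3 G x y z"
  shows "F = G"
  using ev3_eq_0_imp_0[of "F - G"] assms by simp

section \<open>Coefficients and values of homogeneous forms\<close>

lemma poly_eq_sum_le:
  fixes p :: "'a::comm_semiring_1 poly"
  assumes "degree p \<le> N"
  shows "poly p x = (\<Sum>i\<le>N. coeff p i * x ^ i)"
  unfolding poly_altdef using assms
  by (intro sum.mono_neutral_left) (auto simp: coeff_eq_0)

text \<open>The exponents of \<open>Y\<close> and \<open>Z\<close> determine that of
  \<open>X\<close>, so each inner coefficient is a monomial.\<close>

lemma coeff_coeff_homogeneous3: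
  assumes "homogeneous3 d F"
  shows "coeff (coeff F k) j =
    (if j + k \<le> d then monom (coeff3 F (d - j - k) j k) (d - j - k) else 0)"
proof (rule poly_eqI)
  fix i
  have "coeff3 F i j k \<noteq> 0 \<longrightarrow> i + j + k = d"
    using assms unfolding homogeneous3_def by blast
  then show "coeff (coeff (coeff F k) j) i = coeff (if j + k \<le> d
      then monom (coeff3 F (d - j - k) j k) (d - j - k) else 0) i"
    by (auto simp: coeff3_def)
qed

lemma degree_coeff_homogeneous3:
  assumes "homogeneous3 d F"
  shows "degree (coeff F k) \<le> d - k"
  using coeff_coeff_homogeneous3[OF assms] by (intro degree_le) auto

lemma coeff_homogeneous3_eq_0:
  assumes "homogeneous3 d F" "k > d"
  shows "coeff F k = 0"
  using coeff_coeff_homogeneous3[OF assms(1)] assms(2) by (intro poly_eqI) auto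

lemma degree_homogeneous3:
  assumes "homogeneous3 d F"
  shows "degree F \<le> d"
  using coeff_homogeneous3_eq_0[OF assms] by (intro degree_le) auto

lemma ev3_homogeneous3:
  assumes "homogeneous3 d F"
  shows "ev3 F x y z = (\<Sum>k\<le>d. \<Sum>j\<le>d - k. coeff3 F (d - j - k) j k * x ^ (d - j - k) * y ^ j * z ^ k)"
proof -
  have 1: "[:[:z:]:] ^ k = [:[:z ^ k:]:]" "[:y:] ^ k = [:y ^ k:]" for k
    by (induction k) (simp_all add: one_pCons)
  have "ev3 F x y z = (\<Sum>k\<le>d. \<Sum>j\<le>d - k. poly (coeff (coeff F k) j) x * y ^ j * z ^ k)"
    unfolding ev3_def
    by (simp add: poly_eq_sum_le[OF degree_homogeneous3[OF assms]] poly_sum 1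
        poly_eq_sum_le[OF degree_coeff_homogeneous3[OF assms]] sum_distrib_left ac_simps)
  also have "\<dots> = (\<Sum>k\<le>d. \<Sum>j\<le>d - k. coeff3 F (d - j - k) j k * x ^ (d - j - k) * y ^ j * z ^ k)"
    by (intro sum.cong refl) (simp add: coeff_coeff_homogeneous3[OF assms] poly_monom)
  finally show ?thesis .
qed

lemma ev3_homogeneous3_Z0:
  assumes "homogeneous3 d F"
  shows "ev3 F x y 0 = (\<Sum>j\<le>d. coeff3 F (d - j) j 0 * x ^ (d - j) * y ^ j)"
proof -
  have "(\<Sum>k\<le>d. \<Sum>j\<le>d - k. coeff3 F (d - j - k) j k * x ^ (d - j - k) * y ^ j * 0 ^ k)
     = (\<Sum>k\<in>{0}. \<Sum>j\<le>d - k. coeff3 F (d - j - k) j k * x ^ (d - j - k) * y ^ j * 0 ^ k)"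
    by (intro sum.mono_neutral_right) (auto simp: power_0_left split: if_splits)
  then show ?thesis by (simp add: ev3_homogeneous3[OF assms])
qed

lemma ev3_homogeneous3_scale:
  assumes "homogeneous3 d F"
  shows "ev3 F (t * x) (t * y) (t * z) = t ^ d * ev3 F x y z"
proof -
  have "coeff3 F (d - j - k) j k * (t * x) ^ (d - j - k) * (t * y) ^ j * (t * z) ^ k =
    t ^ d * (coeff3 F (d - j - k) j k * x ^ (d - j - k) * y ^ j * z ^ k)"
    if "k \<le> d" "j \<le> d - k" for j k
  proof -
    have "d = (d - j - k) + j + k" using that by simp
    then have "t ^ d = t ^ (d - j - k) * t ^ j * t ^ k" by (metis power_add)
    then show ?thesis by (simp add: power_mult_distrib)
  qed
  then show ?thesis
    by (simp add: ev3_homogeneous3[OF assms] sum_distrib_left)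
qed

lemma ev3_homogeneous3_Y_vertex:
  assumes "homogeneous3 d F"
  shows "ev3 F 0 1 0 = coeff3 F 0 d 0"
proof -
  have "(\<Sum>j\<le>d. coeff3 F (d - j) j 0 * 0 ^ (d - j) * 1 ^ j)
     = (\<Sum>j\<in>{d}. coeff3 F (d - j) j 0 * 0 ^ (d - j) * 1 ^ j)"
    by (intro sum.mono_neutral_right) (auto simp: power_0_left split: if_splits)
  then show ?thesis by (simp add: ev3_homogeneous3_Z0[OF assms])
qed

lemma ev3_homogeneous3_Z_vertex:
  assumes "homogeneous3 d F"
  shows "ev3 F 0 0 1 = coeff3 F 0 0 d"
proof -
  have "ev3 F 0 0 1 = (\<Sum>k\<le>d. coeff3 F (d - k) 0 k * 0 ^ (d - k))"
  proof (unfold ev3_homogeneous3[OF assms], intro sum.cong refl)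
    fix k
    have "(\<Sum>j\<le>d - k. coeff3 F (d - j - k) j k * 0 ^ (d - j - k) * 0 ^ j * 1 ^ k)
       = (\<Sum>j\<in>{0}. coeff3 F (d - j - k) j k * 0 ^ (d - j - k) * 0 ^ j * 1 ^ k)"
      by (intro sum.mono_neutral_right) (auto simp: power_0_left split: if_splits)
    then show "(\<Sum>j\<le>d - k. coeff3 F (d - j - k) j k * 0 ^ (d - j - k) * 0 ^ j * 1 ^ k)
       = coeff3 F (d - k) 0 k * 0 ^ (d - k)" by simp
  qed
  also have "\<dots> = (\<Sum>k\<in>{d}. coeff3 F (d - k) 0 k * 0 ^ (d - k))"
    by (intro sum.mono_neutral_right) (auto simp: power_0_left split: if_splits)
  finally show ?thesis by simp
qed

section \<open>Homogeneity under ring operations\<close>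

lemma coeff3_add: "coeff3 (F + G) i j k = coeff3 F i j k + coeff3 G i j k"
  and coeff3_diff: "coeff3 (F - G) i j k = coeff3 F i j k - coeff3 G i j k"
  by (simp_all add: coeff3_def)

lemma coeff3_mult:
  "coeff3 (F * G) i j k = (\<Sum>c\<le>k. \<Sum>b\<le>j. \<Sum>a\<le>i. coeff3 F a b c * coeff3 G (i - a) (j - b) (k - c))"
  by (simp add: coeff3_def coeff_mult coeff_sum)

lemma homogeneous3_add: "homogeneous3 d F \<Longrightarrow> homogeneous3 d G \<Longrightarrow> homogeneous3 d (F + G)"
  and homogeneous3_diff: "homogeneous3 d F \<Longrightarrow> homogeneous3 d G \<Longrightarrow> homogeneous3 d (F - G)"
  unfolding homogeneous3_def coeff3_add coeff3_diff by force+

lemma homogeneous3_mult: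
  assumes "homogeneous3 d F" "homogeneous3 e G"
  shows "homogeneous3 (d + e) (F * G)"
  unfolding homogeneous3_def
proof (intro allI impI)
  fix i j k assume "coeff3 (F * G) i j k \<noteq> 0"
  then obtain c where "c \<le> k" "(\<Sum>b\<le>j. \<Sum>a\<le>i. coeff3 F a b c * coeff3 G (i - a) (j - b) (k - c)) \<noteq> 0"
    unfolding coeff3_mult by (metis (no_types, lifting) atMost_iff sum.not_neutral_contains_not_neutral)
  moreover from this obtain b where "b \<le> j" "(\<Sum>a\<le>i. coeff3 F a b c * coeff3 G (i - a) (j - b) (k - c)) \<noteq> 0"
    by (metis (no_types, lifting) atMost_iff sum.not_neutral_contains_not_neutral)
  moreover from this obtain a where "a \<le> i" "coeff3 F a b c * coeff3 G (i - a) (j - b) (k - c) \<noteq> 0"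
    by (metis (no_types, lifting) atMost_iff sum.not_neutral_contains_not_neutral)
  moreover from this have "coeff3 F a b c \<noteq> 0" "coeff3 G (i - a) (j - b) (k - c) \<noteq> 0" by auto
  then have "a + b + c = d" "(i - a) + (j - b) + (k - c) = e"
    using assms unfolding homogeneous3_def by blast+
  ultimately show "i + j + k = d + e" by linarith
qed

lemma homogeneous3_C3: "homogeneous3 0 (C3 c)"
  by (simp add: homogeneous3_def coeff3_def C3_def coeff_pCons split: nat.splits)

lemma homogeneous3_1: "homogeneous3 0 1"
  using homogeneous3_C3[of 1] by (simp add: C3_def one_pCons)

lemma homogeneous3_X3: "homogeneous3 1 X3" and homogeneous3_Y3: "homogeneous3 1 Y3"
  and homogeneous3_Z3: "homogeneous3 1 Z3"
  by (simp_all add: homogeneous3_def coeff3_def X3_def Y3_def Z3_def coeff_pCons split: nat.splits)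

lemma homogeneous3_power: "homogeneous3 d F \<Longrightarrow> homogeneous3 (d * m) (F ^ m)"
  by (induction m) (auto simp: homogeneous3_1 intro: homogeneous3_mult)

lemma homogeneous3_hermitian: "homogeneous3 (n + 1) (hermitian n)"
proof -
  have "homogeneous3 (n + 1) (Y3 ^ n * Z3)" "homogeneous3 (n + 1) (X3 ^ (n + 1))"
    "homogeneous3 (1 + n) (Y3 * Z3 ^ n)"
    using homogeneous3_mult[OF homogeneous3_power[OF homogeneous3_Y3, of n] homogeneous3_Z3]
      homogeneous3_power[OF homogeneous3_X3, of "n + 1"]
      homogeneous3_mult[OF homogeneous3_Y3 homogeneous3_power[OF homogeneous3_Z3, of n]]
    by simp_all
  then show ?thesis unfolding hermitian_def
    by (intro homogeneous3_diff homogeneous3_add) simp_all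
qed

text \<open>At \<open>z = 1\<close> this exposes the coefficient of \<open>x ^ (d - i)\<close> as a
  polynomial in \<open>y\<close> of degree at most \<open>i\<close>.\<close>

lemma ev3_homogeneous3_by_X_degree:
  assumes "homogeneous3 d F"
  shows "ev3 F x y z = (\<Sum>i\<le>d. \<Sum>j\<le>i. coeff3 F (d - i) j (i - j) * x ^ (d - i) * y ^ j * z ^ (i - j))"
proof -
  define t where "t k j = coeff3 F (d - j - k) j k * x ^ (d - j - k) * y ^ j * z ^ k" for j k
  have "ev3 F x y z = (\<Sum>k\<le>d. \<Sum>j\<le>d - k. t k j)"
    unfolding ev3_homogeneous3[OF assms] t_def ..
  also have "\<dots> = (\<Sum>(k, j)\<in>{(k, j). k + j \<le> d}. t k j)"
    by (subst sum.Sigma) (auto intro!: sum.cong)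
  also have "\<dots> = (\<Sum>i\<le>d. \<Sum>k\<le>i. t k (i - k))"
    by (rule sum.triangle_reindex_eq)
  also have "\<dots> = (\<Sum>i\<le>d. \<Sum>j\<le>i. t (i - j) j)"
  proof (rule sum.cong[OF refl])
    fix i
    show "(\<Sum>k\<le>i. t k (i - k)) = (\<Sum>j\<le>i. t (i - j) j)"
      by (rule sum.reindex_bij_witness[of _ "\<lambda>j. i - j" "\<lambda>j. i - j"]) auto
  qed
  finally show ?thesis by (simp add: t_def)
qed

text \<open>Lets \<open>F\<close> be treated as a polynomial in \<open>Z\<close> with roots in
  \<open>K[X][Y]\<close>.\<close>

lemma poly_poly_poly_eq_ev3:
  "poly (poly (poly F r) [:y:]) x = ev3 F x y (poly (poly r [:y:]) x)"
  unfolding ev3_def by (induction F) simp_all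

section \<open>Algebraically closed fields of positive characteristic\<close>

text \<open>Splits off one root at a time. The derivative at that root is the value of the cofactor
  there, so the root does not recur.\<close>

lemma card_roots_separable:
  fixes f :: "'k::field poly"
  assumes closed: "\<forall>f :: 'k poly. degree f \<ge> 1 \<longrightarrow> (\<exists>x. poly f x = 0)"
    and "f \<noteq> 0" "\<And>x. poly f x = 0 \<Longrightarrow> poly (pderiv f) x \<noteq> 0"
  shows "card {x. poly f x = 0} = degree f"
  using assms(2,3)
proof (induction "degree f" arbitrary: f)
  case 0
  then obtain c where "f = [:c:]" "c \<noteq> 0" by (metis degree_eq_zeroE pCons_0_0)
  then show ?case by simp
next
  case (Suc e)
  then have "degree f \<ge> 1" by simp
  then obtain a where a: "poly f a = 0" using closed by blast
  then obtain g where g: "f = [:-a, 1:] * g" by (meson dvdE poly_eq_0_iff_dvd)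
  have g0: "g \<noteq> 0" using Suc.prems(1) g by auto
  have der: "pderiv f = g + [:-a, 1:] * pderiv g"
    unfolding g pderiv_mult by (simp add: pderiv_pCons)
  have ga: "poly g a \<noteq> 0"
    using Suc.prems(2)[OF a] by (simp add: der)
  have deg: "degree f = Suc (degree g)"
    using g0 by (subst g, subst degree_mult_eq) auto
  have "card {x. poly g x = 0} = degree g"
  proof (rule Suc.hyps(1))
    show "e = degree g" using deg Suc.hyps(2) by simp
    show "poly (pderiv g) x \<noteq> 0" if "poly g x = 0" for x
      using Suc.prems(2)[of x] that by (auto simp: der) (simp add: g)
  qed (fact g0)
  moreover have "{x. poly f x = 0} = insert a {x. poly g x = 0}"
    by (auto simp: g)
  ultimately show ?case
    using ga poly_roots_finite[OF g0] deg by simp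
qed

lemma pcompose_power: "pcompose (p ^ k) q = pcompose p q ^ k"
  for p q :: "'a::comm_ring_1 poly"
  by (induction k) (simp_all add: pcompose_mult pcompose_1)

section \<open>Frobenius, norm and trace\<close>

locale closed_field_char =
  fixes p n :: nat and K :: "'k::field itself"
  assumes prime_p: "prime p"
    and n_power: "\<exists>m\<ge>1. n = p ^ m"
    and char_K: "CHAR('k) = p"
    and closed: "\<forall>f :: 'k poly. degree f \<ge> 1 \<longrightarrow> (\<exists>x. poly f x = 0)"
begin

definition Fq :: "'k set" where "Fq = {x. x ^ n\<^sup>2 = x}"

lemma n_ge_2: "n \<ge> 2"
  using n_power prime_ge_2_nat[OF prime_p]
  by (metis le_trans power_increasing power_one_right prime_ge_1_nat prime_p)

lemma of_nat_n: "of_nat n = (0 :: 'k)"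
proof -
  obtain m where "m \<ge> 1" "n = p ^ m" using n_power by blast
  then show ?thesis unfolding of_nat_eq_0_iff_char_dvd char_K by (simp add: dvd_power)
qed

lemma frob_add: "(x + y :: 'k) ^ n = x ^ n + y ^ n"
  using n_power freshmans_dream'[of n _ x y] prime_p char_K by auto

lemma frob_minus: "(- x :: 'k) ^ n = - (x ^ n)"
  using frob_add[of x "- x"] n_ge_2 by (simp add: power_0_left add_eq_0_iff)

lemma frob_diff: "(x - y :: 'k) ^ n = x ^ n - y ^ n"
  using frob_add[of x "- y"] by (simp add: frob_minus)

lemma frob_eq_1: "x ^ n = 1 \<Longrightarrow> x = (1 :: 'k)"
  using frob_diff[of x 1] by simp

text \<open>Over a finite field, one plus the product of all \<open>[:-a, 1:]\<close> would have no
  root.\<close>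

lemma infinite_K: "infinite (UNIV :: 'k set)"
proof
  assume fin: "finite (UNIV :: 'k set)"
  define f where "f = (\<Prod>a\<in>(UNIV::'k set). [:-a, 1:])"
  have "degree f = card (UNIV :: 'k set)"
    unfolding f_def by (subst degree_prod_sum_eq) auto
  then have "degree f \<ge> 1" using fin by (metis One_nat_def Suc_leI UNIV_not_empty card_gt_0_iff)
  then have "degree (f + 1) \<ge> 1" by (simp add: degree_add_eq_left)
  then obtain x where "poly (f + 1) x = 0" using closed by blast
  moreover have "poly f x = 0" unfolding f_def poly_prod using fin by (auto simp: prod_zero_iff)
  ultimately show False by simp
qed

lemma in_Fq_iff: "x \<in> Fq \<longleftrightarrow> (x ^ n) ^ n = x"
  by (simp add: Fq_def power2_eq_square power_mult)

text \<open>As \<open>n\<close> is zero in \<open>K\<close>, the derivative of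
  \<open>T^(n^2) - T\<close> is \<open>-1\<close>, so all roots are simple.\<close>

lemma card_Fq: "card Fq = n\<^sup>2"
proof -
  define f :: "'k poly" where "f = monom 1 (n\<^sup>2) - [:0, 1:]"
  have n2: "n\<^sup>2 > 1" using n_ge_2 by (metis one_less_power less_le_trans one_less_numeral_iff semiring_norm(76) zero_less_numeral)
  then have deg: "degree f = n\<^sup>2" unfolding f_def
    by (subst diff_conv_add_uminus, subst degree_add_eq_left) (auto simp: degree_monom_eq)
  have "pderiv f = - 1"
    by (simp add: f_def pderiv_diff pderiv_monom of_nat_n pderiv_pCons one_pCons)
  moreover have "f \<noteq> 0" using deg n2 by auto
  ultimately have "card {x. poly f x = 0} = degree f"
    by (intro card_roots_separable[OF closed]) auto
  moreover have "{x. poly f x = 0} = Fq" by (auto simp: f_def Fq_def poly_monom)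
  ultimately show ?thesis using deg by simp
qed

lemma card_trace_fibre: "card {c :: 'k. c + c ^ n = t} = n"
proof -
  define f :: "'k poly" where "f = monom 1 n + [:- t, 1:]"
  have deg: "degree f = n" unfolding f_def using n_ge_2
    by (subst degree_add_eq_left) (auto simp: degree_monom_eq)
  have "pderiv f = 1"
    by (simp add: f_def pderiv_add pderiv_monom of_nat_n pderiv_pCons one_pCons)
  moreover have "f \<noteq> 0" using deg n_ge_2 by auto
  ultimately have "card {x. poly f x = 0} = degree f"
    by (intro card_roots_separable[OF closed]) auto
  moreover have "{x. poly f x = 0} = {c. c + c ^ n = t}"
    by (auto simp: f_def poly_monom algebra_simps)
  ultimately show ?thesis using deg by simp
qed

text \<open>The derivative is \<open>T^n\<close>, whose only root 0 is not a root of
  \<open>T^(n+1) - 1\<close>.\<close>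

lemma card_norm_kernel: "card {x :: 'k. x ^ (n + 1) = 1} = n + 1"
proof -
  define f :: "'k poly" where "f = monom 1 (n + 1) - 1"
  have deg: "degree f = n + 1" unfolding f_def
    by (subst diff_conv_add_uminus, subst degree_add_eq_left) (auto simp: degree_monom_eq)
  have "pderiv f = monom 1 n"
    by (simp add: f_def pderiv_diff pderiv_monom of_nat_n)
  moreover have "f \<noteq> 0" using deg by auto
  ultimately have "card {x. poly f x = 0} = degree f"
    using n_ge_2 by (intro card_roots_separable[OF closed]) (auto simp: poly_monom f_def)
  moreover have "{x. poly f x = 0} = {x. x ^ (n + 1) = 1}"
    by (auto simp: f_def poly_monom)
  ultimately show ?thesis using deg by simp
qed

lemma ex_root: "N > 0 \<Longrightarrow> \<exists>x :: 'k. x ^ N = a"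
proof -
  assume N: "N > 0"
  define f :: "'k poly" where "f = monom 1 N - [:a:]"
  have "degree f = N" unfolding f_def using N
    by (subst diff_conv_add_uminus, subst degree_add_eq_left) (auto simp: degree_monom_eq)
  then obtain x where "poly f x = 0" using closed N by (metis One_nat_def Suc_leI)
  then show ?thesis by (auto simp: f_def poly_monom)
qed

text \<open>Otherwise the remainder \<open>r\<close> of \<open>d\<close> modulo \<open>n + 1\<close>
  is positive and \<open>T^r - 1\<close> has \<open>n + 1 > r\<close> roots.\<close>

lemma n_plus_1_dvd_if_norm_kernel:
  assumes "\<And>x :: 'k. x ^ (n + 1) = 1 \<Longrightarrow> x ^ d = 1"
  shows "n + 1 dvd d"
proof (rule ccontr)
  assume "\<not> n + 1 dvd d"
  define r where "r = d mod (n + 1)"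
  have r: "0 < r" "r < n + 1"
    using \<open>\<not> n + 1 dvd d\<close> unfolding r_def by (auto simp: dvd_eq_mod_eq_0 simp del: Suc_eq_plus1)
  define f :: "'k poly" where "f = monom 1 r - 1"
  have deg: "degree f = r" unfolding f_def using r
    by (subst diff_conv_add_uminus, subst degree_add_eq_left) (auto simp: degree_monom_eq)
  have f0: "f \<noteq> 0" using deg r by auto
  have "{x :: 'k. x ^ (n + 1) = 1} \<subseteq> {x. poly f x = 0}"
  proof
    fix x :: 'k assume "x \<in> {x. x ^ (n + 1) = 1}"
    then have x: "x ^ (n + 1) = 1" by simp
    have "x ^ d = (x ^ (n + 1)) ^ (d div (n + 1)) * x ^ r"
      unfolding r_def power_mult[symmetric] power_add[symmetric] by (simp only: mult_div_mod_eq)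
    then show "x \<in> {x. poly f x = 0}" using x assms[OF x] by (simp add: f_def poly_monom)
  qed
  then have "n + 1 \<le> card {x. poly f x = 0}"
    using card_mono[OF poly_roots_finite[OF f0]] card_norm_kernel by metis
  then show False using card_poly_roots_bound[OF f0] deg r by simp
qed

text \<open>The norm \<open>b ^ (n + 1)\<close> is fixed by the \<open>n\<close>-th power map;
  applying that map to the equation and comparing gives \<open>(c ^ n) ^ n = c\<close>.\<close>

lemma trace_norm_imp_in_Fq:
  assumes "b \<in> Fq" "c + c ^ n = b ^ (n + 1)"
  shows "c \<in> Fq"
proof -
  have "(b ^ (n + 1)) ^ n = b ^ (n + 1)"
    using assms(1) by (simp add: in_Fq_iff power_mult_distrib mult.commute)
  then have "c ^ n + (c ^ n) ^ n = c + c ^ n"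
    using assms(2) by (metis frob_add)
  then show ?thesis by (simp add: in_Fq_iff algebra_simps)
qed

text \<open>The trace is fixed by the \<open>n\<close>-th power map, so any
  \<open>(n + 1)\<close>-th root \<open>b\<close> of it satisfies
  \<open>b ^ (n + 1) = (b ^ (n + 1)) ^ n\<close>; cancelling \<open>b ^ n\<close> puts
  \<open>b\<close> in \<open>Fq\<close>.\<close>

lemma ex_norm_eq_trace:
  assumes "c \<in> Fq"
  obtains b where "b \<in> Fq" "b ^ (n + 1) = c + c ^ n"
proof -
  obtain b :: 'k where b: "b ^ (n + 1) = c + c ^ n" using ex_root[of "n + 1"] by auto
  have "(c + c ^ n) ^ n = c + c ^ n"
    using assms by (simp add: frob_add in_Fq_iff)
  then have "b ^ (n + 1) = (b ^ (n + 1)) ^ n" using b by simp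
  then have "b * b ^ n = b ^ n * (b ^ n) ^ n"
    by (simp add: power_mult_distrib mult.commute)
  then have "b \<in> Fq" by (cases "b = 0") (auto simp: in_Fq_iff)
  then show ?thesis using that b by blast
qed

subsection \<open>Forms invariant under unipotent unitary maps\<close>

text \<open>Formulated for functions, so that the mirror maps \<open>l(b,c)\<close> are covered by
  exchanging two arguments. The condition on \<open>c\<close> makes \<open>u(b,c)\<close> preserve
  the Hermitian form.\<close>

definition U_invariant :: "('k \<Rightarrow> 'k \<Rightarrow> 'k \<Rightarrow> 'k) \<Rightarrow> bool" where
  "U_invariant f \<longleftrightarrow> (\<forall>b c x y z. b \<in> Fq \<longrightarrow> c + c ^ n = b ^ (n + 1) \<longrightarrow>
     f (x + b * z) (y + b ^ n * x + c * z) z = f x y z)"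

definition UL_invariant :: "('k \<Rightarrow> 'k \<Rightarrow> 'k \<Rightarrow> 'k) \<Rightarrow> bool" where
  "UL_invariant f \<longleftrightarrow> U_invariant f \<and> U_invariant (\<lambda>x y z. f x z y)"

lemma U_invariantD:
  assumes "UL_invariant f" "b \<in> Fq" "c + c ^ n = b ^ (n + 1)"
  shows "f (x + b * z) (y + b ^ n * x + c * z) z = f x y z"
  using assms unfolding UL_invariant_def U_invariant_def by blast

lemma L_invariantD:
  assumes "UL_invariant f" "b \<in> Fq" "c + c ^ n = b ^ (n + 1)"
  shows "f (x + b * y) y (z + b ^ n * x + c * y) = f x y z"
  using assms unfolding UL_invariant_def U_invariant_def by blast

text \<open>The transformation has order dividing \<open>n\<^sup>2\<close>, and \<open>K\<close> contains no nontrivial roots of unity of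
  \<open>p\<close>-power order.\<close>
lemma semi_invariant_multiplier_eq_1:
  fixes b c :: 'k
  assumes f: "\<And>x y z. f (x + b * z) (y + b ^ n * x + c * z) z = \<theta> * f x y z"
    and nz: "f x0 y0 z0 \<noteq> (0 :: 'k)"
  shows "\<theta> = 1"
proof -
  have "\<exists>t. \<forall>x y z. f (x + of_nat k * b * z) (y + of_nat k * b ^ n * x + t * z) z = \<theta> ^ k * f x y z" for k
  proof (induction k)
    case 0
    show ?case by (intro exI[of _ 0]) simp
  next
    case (Suc k)
    then obtain t where t: "\<And>x y z. f (x + of_nat k * b * z) (y + of_nat k * b ^ n * x + t * z) z = \<theta> ^ k * f x y z"
      by blast
    show ?case
    proof (intro exI[of _ "t + of_nat k * b * b ^ n + c"] allI)
      fix x y z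
      have "f (x + of_nat (Suc k) * b * z) (y + of_nat (Suc k) * b ^ n * x + (t + of_nat k * b * b ^ n + c) * z) z
          = f ((x + of_nat k * b * z) + b * z)
              ((y + of_nat k * b ^ n * x + t * z) + b ^ n * (x + of_nat k * b * z) + c * z) z"
        by (rule arg_cong2[of _ _ _ _ "\<lambda>u v. f u v z"]) (simp_all add: algebra_simps)
      also have "\<dots> = \<theta> * (\<theta> ^ k * f x y z)"
        by (simp only: f t)
      finally show "f (x + of_nat (Suc k) * b * z) (y + of_nat (Suc k) * b ^ n * x + (t + of_nat k * b * b ^ n + c) * z) z
          = \<theta> ^ Suc k * f x y z"
        by (simp only: power_Suc mult.assoc)
    qed
  qed
  \<comment> \<open>At \<open>k = n\<close> the multiples of \<open>b\<close> vanish, leaving the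
    shift of \<open>y\<close> by \<open>t * z\<close>; iterating this shift \<open>n\<close> times
    gives the identity.\<close>
  from this[of n] obtain t where t: "\<And>x y z. f x (y + t * z) z = \<theta> ^ n * f x y z"
    by (auto simp: of_nat_n)
  have "f x (y + of_nat k * t * z) z = (\<theta> ^ n) ^ k * f x y z" for k x y z
  proof (induction k)
    case (Suc k)
    have "f x (y + of_nat (Suc k) * t * z) z = f x ((y + of_nat k * t * z) + t * z) z"
      by (rule arg_cong[of _ _ "\<lambda>v. f x v z"]) (simp add: algebra_simps)
    also have "\<dots> = \<theta> ^ n * ((\<theta> ^ n) ^ k * f x y z)"
      by (simp only: t Suc)
    finally show ?case by (simp only: power_Suc mult.assoc)
  qed simp
  from this[of x0 y0 n z0] have "(\<theta> ^ n) ^ n = 1" using nz by (simp add: of_nat_n)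
  then show ?thesis using frob_eq_1 by blast
qed

lemma Fq_power: "b \<in> Fq \<Longrightarrow> b ^ k \<in> Fq"
  unfolding Fq_def by (simp add: power_mult[symmetric]) (metis power_mult mult.commute)

text \<open>The points \<open>(0, 1, 0)\<close> and \<open>(0, 0, c)\<close> are joined by the element \<open>u(-b/c, c^(-n)) l(b, c)\<close>.\<close>
lemma UL_invariant_vertex:
  assumes "UL_invariant f" "c \<in> Fq" "c \<noteq> 0"
  shows "f 0 0 c = f 0 1 0"
proof -
  obtain b where b: "b \<in> Fq" "b ^ (n + 1) = c + c ^ n" using ex_norm_eq_trace assms(2) by blast
  have cn: "(c ^ n) ^ n = c" "c ^ n \<noteq> 0" using assms by (auto simp: in_Fq_iff)
  have "f 0 1 0 = f b 1 c"
    using L_invariantD[OF assms(1) b(1) b(2)[symmetric], of 0 1 0] by simp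
  also have "\<dots> = f (b + (- b / c) * c) (1 + (- b / c) ^ n * b + (1 / c ^ n) * c) c"
  proof (rule U_invariantD[OF assms(1), symmetric])
    show "- b / c \<in> Fq" using b(1) assms(2)
      by (simp add: in_Fq_iff frob_minus power_divide)
    have "(- b / c) ^ (n + 1) = b ^ (n + 1) / c ^ (n + 1)"
      by (simp add: frob_minus power_divide)
    also have "\<dots> = (c + c ^ n) / c ^ (n + 1)" by (simp only: b(2))
    also have "\<dots> = 1 / c ^ n + (1 / c ^ n) ^ n"
      using assms(3) by (simp add: power_divide cn add_divide_distrib)
    finally show "1 / c ^ n + (1 / c ^ n) ^ n = (- b / c) ^ (n + 1)" by simp
  qed
  also have "1 + (- b / c) ^ n * b + (1 / c ^ n) * c = 0"
  proof -
    have "1 + (- b / c) ^ n * b + (1 / c ^ n) * c = (c ^ n - b ^ (n + 1) + c) / c ^ n"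
      using cn by (simp add: frob_minus power_divide field_simps)
    also have "c ^ n - b ^ (n + 1) + c = 0" by (simp only: b(2)) simp
    finally show ?thesis by simp
  qed
  finally show ?thesis using assms(3) by simp
qed

lemma one_in_Fq: "1 \<in> Fq"
  by (simp add: Fq_def)

text \<open>As a polynomial in \<open>Z\<close> over \<open>K[X,Y]\<close>, the form has the \<open>n\<^sup>3\<close> roots \<open>-(b^n X + cY)\<close>, the
  images of the tangent \<open>Z = 0\<close>; its \<open>Z\<close>-degree is smaller because it vanishes at \<open>(0, 0, 1)\<close>.\<close>
lemma invariant_form_eq_0:
  fixes F :: "'k poly3"
  assumes hom: "homogeneous3 d F" and d: "d \<le> n ^ 3" and inv: "UL_invariant (ev3 F)"
    and Z0: "\<And>x y. ev3 F x y 0 = 0"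
  shows "F = 0"
proof (rule ccontr)
  assume F0: "F \<noteq> 0"
  \<comment> \<open>\<open>F\<close> takes equal values at \<open>(0, 0, 1)\<close> and
    \<open>(0, 1, 0)\<close>, and the latter lies on \<open>Z = 0\<close>. The strict degree bound
    obtained from this is what settles the case \<open>d = n^3\<close>.\<close>
  have "coeff3 F 0 0 d = 0"
    using UL_invariant_vertex[OF inv one_in_Fq] Z0 ev3_homogeneous3_Z_vertex[OF hom] by simp
  then have "coeff F d = 0"
    by (intro poly_eqI) (simp add: coeff_coeff_homogeneous3[OF hom])
  then have deg: "degree F < d"
    using F0 degree_homogeneous3[OF hom] by (metis leading_coeff_0_iff nless_le)
  define S where "S = (SIGMA b:Fq. {c. c + c ^ n = b ^ (n + 1)})"
  define r where "r = (\<lambda>(b :: 'k, c :: 'k). [:[:0, - (b ^ n):], [:- c:]:])"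
  have "card S = n ^ 3"
    unfolding S_def using card_Fq card_trace_fibre n_ge_2
    by (subst card_SigmaI) (auto intro: card_ge_0_finite simp: power2_eq_square power3_eq_cube)
  moreover have "inj_on r S"
  proof (rule inj_onI)
    fix u v assume "u \<in> S" "v \<in> S" "r u = r v"
    moreover obtain b c b' c' where "u = (b, c)" "v = (b', c')" by (metis surj_pair)
    ultimately have "b \<in> Fq" "b' \<in> Fq" "b ^ n = b' ^ n" "c = c'" "u = (b, c)" "v = (b', c')"
      by (auto simp: S_def r_def)
    then show "u = v" by (metis in_Fq_iff)
  qed
  ultimately have "card (r ` S) = n ^ 3" by (simp add: card_image)
  moreover have "r ` S \<subseteq> {s. poly F s = 0}"
  proof clarify
    fix b c assume bc: "(b, c) \<in> S"
    have "poly (poly (poly F (r (b, c))) [:y:]) x = 0" for x y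
    proof -
      have "poly (poly (poly F (r (b, c))) [:y:]) x = ev3 F x y (- (b ^ n * x) - c * y)"
        unfolding poly_poly_poly_eq_ev3
        by (rule arg_cong[of _ _ "ev3 F x y"]) (simp add: r_def algebra_simps)
      \<comment> \<open>\<open>l(b,c)\<close> carries this point to one with third coordinate
        0.\<close>
      also have "\<dots> = ev3 F (x + b * y) y (- (b ^ n * x) - c * y + b ^ n * x + c * y)"
        using bc by (intro L_invariantD[OF inv, symmetric]) (auto simp: S_def)
      finally show ?thesis by (simp add: Z0)
    qed
    then have "poly (poly F (r (b, c))) [:y:] = 0" for y
      by (intro poly_eq_0_if_infinite_roots[OF infinite_K]) auto
    moreover have "infinite (range (\<lambda>y::'k. [:y:]))"
      using infinite_K by (auto simp: finite_image_iff inj_on_def)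
    ultimately show "poly F (r (b, c)) = 0"
      by (intro poly_eq_0_if_infinite_roots) auto
  qed
  ultimately have "n ^ 3 \<le> card {s. poly F s = 0}"
    using card_mono[OF poly_roots_finite[OF F0]] by metis
  then show False using card_poly_roots_bound[OF F0] deg d by linarith
qed

section \<open>Restriction to the tangent line \<open>Z = 0\<close>\<close>

text \<open>At \<open>z = 1\<close> the coefficient of \<open>x ^ (d - i)\<close> is
  \<open>h i\<close>, of degree at most \<open>i < n\<close> in \<open>y\<close>. By the maps
  \<open>u(0,c)\<close> it takes one value at all \<open>n\<close> elements of trace zero, so it is
  constant.\<close>

lemma invariant_form_coeff_eq_0:
  fixes F :: "'k poly3"
  assumes hom: "homogeneous3 d F" and inv: "UL_invariant (ev3 F)"
    and i: "0 < i" "i < n" "i \<le> d"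
  shows "coeff3 F (d - i) i 0 = 0"
proof -
  define h where "h i = (\<Sum>j\<le>i. monom (coeff3 F (d - i) j (i - j)) j)" for i
  define P where "P y = (\<Sum>i\<le>d. monom (poly (h i) y) (d - i))" for y
  have P: "poly (P y) x = ev3 F x y 1" for x y
    by (simp add: P_def h_def poly_sum poly_monom ev3_homogeneous3_by_X_degree[OF hom]
        sum_distrib_right sum_distrib_left ac_simps)
  have coeff_P: "coeff (P y) (d - i) = poly (h i) y" for y
  proof -
    have "coeff (P y) (d - i) = (\<Sum>i'\<le>d. if i' = i then poly (h i') y else 0)"
      unfolding P_def coeff_sum using i by (intro sum.cong) auto
    then show ?thesis using i by simp
  qed
  define g where "g = h i - [:poly (h i) 0:]"
  have "poly g c = 0" if "c + c ^ n = 0" for c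
  proof -
    have "ev3 F x c 1 = ev3 F x 0 1" for x
      using U_invariantD[OF inv, of 0 c x 1 0] that n_ge_2 by (simp add: Fq_def power_0_left)
    then have "P c - P 0 = 0"
      by (intro poly_eq_0_if_infinite_roots[OF infinite_K]) (simp add: P)
    then have "coeff (P c) (d - i) = coeff (P 0) (d - i)" by simp
    then show ?thesis by (simp add: coeff_P g_def)
  qed
  then have sub: "{c. c + c ^ n = 0} \<subseteq> {c. poly g c = 0}" by auto
  have "degree (h i) \<le> i"
    unfolding h_def by (intro degree_sum_le) (auto intro: order_trans[OF degree_monom_le])
  then have "degree g \<le> i"
    unfolding g_def by (intro degree_diff_le) auto
  then have "g = 0"
    using card_mono[OF poly_roots_finite sub] card_trace_fibre[of 0] card_poly_roots_bound[of g] i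
    by fastforce
  then have "coeff (h i) i = 0"
    using i by (simp add: g_def coeff_pCons split: nat.splits) (metis coeff_pCons_Suc coeff_0 not0_implies_Suc not_gr_zero)
  moreover have "coeff (h i) i = coeff3 F (d - i) i 0"
    by (simp add: h_def coeff_sum)
  ultimately show ?thesis by simp
qed

text \<open>The value at \<open>(0, 0, c)\<close> is the same for all nonzero \<open>c\<close> in
  \<open>Fq\<close>, yet it scales by \<open>c ^ n ^ 3 = c ^ n\<close>, which is not 1 when
  \<open>c\<close> is not 1.\<close>

lemma UL_invariant_vertex_eq_0:
  assumes hom: "homogeneous3 (n ^ 3) F" and inv: "UL_invariant (ev3 F)"
  shows "ev3 F 0 1 0 = 0"
proof -
  have "card {0, 1 :: 'k} < card Fq"
    using n_ge_2 power_mono[OF n_ge_2, of 2] by (simp add: card_Fq)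
  then have "\<not> Fq \<subseteq> {0, 1}"
    using card_mono[of "{0, 1 :: 'k}" Fq] by auto
  then obtain c where c: "c \<in> Fq" "c \<noteq> 0" "c \<noteq> 1" by blast
  have "c ^ n ^ 3 = ((c ^ n) ^ n) ^ n"
    by (simp add: power3_eq_cube power_mult)
  also have "\<dots> = c ^ n" using c(1) by (simp add: in_Fq_iff)
  finally have "c ^ n ^ 3 \<noteq> 1" using frob_eq_1 c(3) by metis
  moreover have "ev3 F 0 0 c = c ^ n ^ 3 * ev3 F 0 0 1"
    using ev3_homogeneous3_scale[OF hom, of c 0 0 1] by simp
  ultimately show ?thesis
    using UL_invariant_vertex[OF inv c(1,2)] UL_invariant_vertex[OF inv one_in_Fq] by auto
qed

text \<open>Composition with \<open>y + a\<close> turns a factor \<open>y ^ s\<close> of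
  \<open>T\<close> into \<open>(y + a) ^ s\<close>.\<close>

lemma order_0_le_order_if_translation_invariant:
  fixes T :: "'k poly"
  assumes "T \<noteq> 0" "\<And>y. poly T (y + a) = poly T y"
  shows "order 0 T \<le> order (- a) T"
proof -
  obtain R where R: "T = [:0, 1:] ^ order 0 T * R"
    using order_decomp[OF assms(1), of 0] by auto
  have "pcompose T [:a, 1:] - T = 0"
    using assms(2) by (intro poly_eq_0_if_infinite_roots[OF infinite_K]) (simp add: poly_pcompose add.commute)
  then have "T = pcompose T [:a, 1:]" by simp
  also have "\<dots> = [:a, 1:] ^ order 0 T * pcompose R [:a, 1:]"
    by (subst R) (simp add: pcompose_mult pcompose_power pcompose_pCons)
  finally have "[:- (- a), 1:] ^ order 0 T dvd T" by (metis dvd_triv_left minus_minus)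
  then show ?thesis using assms(1) order_divides[of "- a" "order 0 T" T] by simp
qed

lemma invariant_form_Z0:
  assumes hom: "homogeneous3 d F" and d: "d \<le> n ^ 3" and inv: "UL_invariant (ev3 F)"
  shows "ev3 F x y 0 = coeff3 F d 0 0 * x ^ d"
proof -
  define G where "G = (\<Sum>j\<le>d. monom (coeff3 F (d - j) j 0) j)"
  have coeff_G: "coeff G i = (if i \<le> d then coeff3 F (d - i) i 0 else 0)" for i
    by (simp add: G_def coeff_sum)
  have poly_G: "poly G y = ev3 F 1 y 0" for y
    by (simp add: G_def poly_sum poly_monom ev3_homogeneous3_Z0[OF hom])
  have "degree G \<le> d" by (intro degree_le) (simp add: coeff_G)
  \<comment> \<open>In the boundary case \<open>d = n ^ 3\<close> the top coefficient is the value
    at \<open>(0, 1, 0)\<close>, which vanishes.\<close>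
  have deg: "degree G < n ^ 3"
  proof (cases "d = n ^ 3")
    case True
    then have "coeff G d = 0"
      using UL_invariant_vertex_eq_0[of F] inv hom ev3_homogeneous3_Y_vertex[OF hom]
      by (simp add: coeff_G)
    moreover have "d > 0" using True n_ge_2 by simp
    ultimately have "degree G \<noteq> d" by (metis leading_coeff_0_iff degree_0 less_irrefl)
    then show ?thesis using \<open>degree G \<le> d\<close> d by linarith
  qed (use d \<open>degree G \<le> d\<close> in linarith)
  have trans: "poly G (y + a) = poly G y" if "a \<in> Fq" for a y
  proof -
    \<comment> \<open>On \<open>Z = 0\<close> the map \<open>u(b,c)\<close> acts as
      \<open>y \<mapsto> y + b^n x\<close>, so \<open>b = a ^ n\<close> gives translation by
      \<open>a\<close>, with any \<open>c\<close> of matching trace.\<close>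
    have a: "a ^ n \<in> Fq" "(a ^ n) ^ n = a" using that Fq_power by (auto simp: in_Fq_iff)
    have "{c. c + c ^ n = (a ^ n) ^ (n + 1)} \<noteq> {}"
      using card_trace_fibre[of "(a ^ n) ^ (n + 1)"] n_ge_2 by (metis card.empty not_numeral_le_zero)
    then obtain c where "c + c ^ n = (a ^ n) ^ (n + 1)" by blast
    from U_invariantD[OF inv a(1) this, of 1 0 y] show ?thesis
      by (simp add: a poly_G)
  qed
  define T where "T = G - [:poly G 0:]"
  have "T = 0"
  proof (rule ccontr)
    assume T0: "T \<noteq> 0"
    have transT: "poly T (y + a) = poly T y" if "a \<in> Fq" for a y
      using trans[OF that] by (simp add: T_def)
    define s where "s = order 0 T"
    have "poly T 0 = 0" by (simp add: T_def)
    then have "s > 0" using T0 by (simp add: s_def order_gt_0_iff)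
    have roots: "poly T a = 0" if "a \<in> Fq" for a
      using transT[OF that, of 0] by (simp add: T_def)
    have "s \<le> order a T" if "a \<in> Fq" for a
    proof -
      have "- a \<in> Fq" using that by (simp add: in_Fq_iff frob_minus)
      from order_0_le_order_if_translation_invariant[OF T0 transT[OF this]] show ?thesis
        by (simp add: s_def)
    qed
    then have "card Fq * s \<le> (\<Sum>a\<in>Fq. order a T)"
      using sum_mono[of Fq "\<lambda>_. s" "\<lambda>a. order a T"] by simp
    also have "\<dots> \<le> (\<Sum>a | poly T a = 0. order a T)"
      using roots by (intro sum_mono2 poly_roots_finite[OF T0]) auto
    also have "\<dots> \<le> degree T" by (rule sum_order_le_degree[OF T0])
    also have "\<dots> \<le> degree G" unfolding T_def by (intro degree_diff_le) auto
    \<comment> \<open>From \<open>n^2 * s < n^3\<close> one gets \<open>s < n\<close>.\<close>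
    also note deg
    finally have "s < n" by (simp add: card_Fq power2_eq_square power3_eq_cube)
    have "coeff T s = coeff G s"
      using \<open>s > 0\<close> by (cases s) (simp_all add: T_def)
    also have "\<dots> = 0"
      using invariant_form_coeff_eq_0[OF hom inv \<open>s > 0\<close> \<open>s < n\<close>] by (simp add: coeff_G)
    finally have "coeff T s = 0" .
    \<comment> \<open>\<open>s\<close> is the exact order at 0, so the coefficient at
      \<open>s\<close> is the nonzero constant term of \<open>R\<close>.\<close>
    obtain R where R: "T = [:0, 1:] ^ s * R" "\<not> [:0, 1:] dvd R"
      using order_decomp[OF T0, of 0] unfolding s_def by auto
    have "[:0, 1:] ^ s = (monom 1 s :: 'k poly)" by (simp add: monom_altdef)
    then have "coeff T s = coeff R 0"
      using R(1) by (simp add: coeff_monom_mult)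
    moreover have "coeff R 0 \<noteq> 0"
      using R(2) by (metis minus_zero poly_0_coeff_0 poly_eq_0_iff_dvd)
    ultimately show False using \<open>coeff T s = 0\<close> by simp
  qed
  then have "G = [:poly G 0:]" by (simp add: T_def)
  then have "coeff G j = 0" if "j > 0" for j
    using that by (metis coeff_0 coeff_pCons_Suc gr0_implies_Suc)
  then have coeff0: "coeff3 F (d - j) j 0 = 0" if "j > 0" "j \<le> d" for j
    using that coeff_G by metis
  have "ev3 F x y 0 = (\<Sum>j\<in>{0}. coeff3 F (d - j) j 0 * x ^ (d - j) * y ^ j)"
    unfolding ev3_homogeneous3_Z0[OF hom] using coeff0 by (intro sum.mono_neutral_right) auto
  then show ?thesis by simp
qed

text \<open>For each \<open>u\<close> of norm one, some \<open>l(b,c)\<close> maps a point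
  \<open>(1, v, 0)\<close> to \<open>(-u, v, 0)\<close>. As \<open>F\<close> restricts to
  \<open>a x^d\<close> there, \<open>(-u)^d = 1\<close>; the case \<open>u = 1\<close> removes the
  sign.\<close>

lemma invariant_form_degree:
  assumes hom: "homogeneous3 d F" and d: "d \<le> n ^ 3" and inv: "UL_invariant (ev3 F)"
    and nz: "coeff3 F d 0 0 \<noteq> 0"
  shows "n + 1 dvd d"
proof (rule n_plus_1_dvd_if_norm_kernel)
  have *: "(- u) ^ d = 1" if u: "u ^ (n + 1) = 1" for u :: 'k
  proof -
    \<comment> \<open>This root gives \<open>c ^ n = c * u\<close>, hence
      \<open>(c ^ n) ^ n = c * u ^ (n + 1) = c\<close>, and \<open>c\<close> has trace
      \<open>c * (1 + u)\<close>.\<close>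
    obtain c where c: "c ^ (n - 1) = u" using ex_root[of "n - 1" u] n_ge_2 by auto
    have "u \<noteq> 0" using u by auto
    then have c0: "c \<noteq> 0" using c n_ge_2 by (auto simp: power_0_left)
    have cn: "c ^ n = c * u" using c n_ge_2 by (metis One_nat_def Suc_pred less_le_trans pos2 power_Suc)
    have "(c ^ n) ^ n = c * (u * u ^ n)"
      by (simp add: cn power_mult_distrib)
    then have "c \<in> Fq" using u by (simp add: in_Fq_iff)
    then obtain b where b: "b \<in> Fq" "b ^ (n + 1) = c + c ^ n" using ex_norm_eq_trace by blast
    \<comment> \<open>The value that keeps the image on \<open>Z = 0\<close>.\<close>
    define v where "v = - (b ^ n) / c"
    have "b * v = - (b ^ (n + 1)) / c" by (simp add: v_def)
    also have "\<dots> = - 1 - u" unfolding b(2) using c0 by (simp add: cn field_simps)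
    finally have bv: "1 + b * v = - u" by simp
    have "ev3 F (1 + b * v) v (0 + b ^ n * 1 + c * v) = ev3 F 1 v 0"
      by (rule L_invariantD[OF inv b(1) b(2)[symmetric]])
    moreover have "0 + b ^ n * 1 + c * v = 0" using c0 by (simp add: v_def)
    ultimately show ?thesis
      using nz by (simp only: bv) (simp add: invariant_form_Z0[OF hom d inv])
  qed
  fix u :: 'k assume u: "u ^ (n + 1) = 1"
  have "(- 1) ^ d = (1 :: 'k)" using *[of 1] by simp
  then show "u ^ d = 1" using *[OF u] by (metis mult_1 power_minus)
qed

lemma UL_invariant_hermitian: "UL_invariant (ev3 (hermitian n :: 'k poly3))"
proof -
  have "U_invariant (ev3 (hermitian n :: 'k poly3))"
    unfolding U_invariant_def
  proof (intro allI impI)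
    fix b c x y z :: 'k
    assume b: "b \<in> Fq" and c: "c + c ^ n = b ^ (n + 1)"
    have cn: "c ^ n = b * b ^ n - c" using c by (simp add: algebra_simps)
    have bn: "(b ^ n) ^ n = b" using b by (simp add: in_Fq_iff)
    show "ev3 (hermitian n) (x + b * z) (y + b ^ n * x + c * z) z = ev3 (hermitian n) x y z"
      by (simp add: ev3_hermitian frob_add power_mult_distrib bn cn) (simp add: algebra_simps)
  qed
  moreover have "(\<lambda>x y z. ev3 (hermitian n :: 'k poly3) x z y) = ev3 (hermitian n)"
    by (intro ext) (simp add: ev3_hermitian algebra_simps)
  ultimately show ?thesis by (simp add: UL_invariant_def)
qed

theorem invariant_form_eq_hermitian_power:
  fixes F :: "'k poly3"
  assumes hom: "homogeneous3 d F" and d: "d \<le> n ^ 3" and inv: "UL_invariant (ev3 F)"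
    and F0: "F \<noteq> 0"
  obtains c k where "c \<noteq> 0" "F = C3 c * hermitian n ^ k" "d = (n + 1) * k"
proof -
  define a where "a = coeff3 F d 0 0"
  have "a \<noteq> 0"
    using invariant_form_eq_0[OF hom d inv] invariant_form_Z0[OF hom d inv] F0
    by (auto simp: a_def)
  then obtain k where k: "d = (n + 1) * k"
    using invariant_form_degree[OF hom d inv] by (auto simp: a_def)
  \<comment> \<open>On \<open>Z = 0\<close> the Hermitian form is \<open>-x^(n+1)\<close>; the sign
    makes the multiple of its \<open>k\<close>-th power restrict to \<open>a x^d\<close>.\<close>
  define c where "c = a * (- 1) ^ k"
  define E where "E = F - C3 c * hermitian n ^ k"
  have "homogeneous3 d (C3 c * hermitian n ^ k)"
    unfolding k
    using homogeneous3_mult[OF homogeneous3_C3 homogeneous3_power[OF homogeneous3_hermitian]]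
    by (metis add_0)
  then have homE: "homogeneous3 d E"
    unfolding E_def by (intro homogeneous3_diff hom)
  have invE: "UL_invariant (ev3 E)"
    using inv UL_invariant_hermitian
    unfolding UL_invariant_def U_invariant_def E_def by simp
  have "ev3 E x y 0 = 0" for x y
  proof -
    have "ev3 (hermitian n :: 'k poly3) x y 0 ^ k = (- 1) ^ k * x ^ d"
      using n_ge_2 unfolding k power_mult
      by (simp add: ev3_hermitian power_0_left power_minus[of "x * x ^ n"])
    moreover have "((- 1) ^ k * (- 1) ^ k :: 'k) = 1" by (simp flip: power_mult_distrib)
    ultimately show ?thesis
      by (simp add: E_def c_def invariant_form_Z0[OF hom d inv] flip: a_def)
  qed
  then have "E = 0" by (rule invariant_form_eq_0[OF homE d invE])
  moreover have "c \<noteq> 0" using \<open>a \<noteq> 0\<close> by (simp add: c_def)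
  ultimately show ?thesis by (intro that[of c k] k) (simp_all add: E_def)
qed

end

section \<open>Irreducibility of the Hermitian form\<close>

lemma hermitian_expand:
  "hermitian N = ([:0, [:0, 1:] ^ N:] + monom [:0, 1:] N - [:[:[:0, 1:] ^ (N + 1):]:] :: 'k::comm_ring_1 poly3)"
proof -
  have "Y3 ^ N = ([:[:0, 1:] ^ N:] :: 'k poly3)"
    by (induction N) (simp_all add: Y3_def one_pCons)
  moreover have "X3 ^ m = ([:[:[:0, 1:] ^ m:]:] :: 'k poly3)" for m
    by (induction m) (simp_all add: X3_def one_pCons)
  moreover have "Z3 ^ N = (monom 1 N :: 'k poly3)"
    by (simp add: Z3_def monom_altdef)
  ultimately show ?thesis
    by (simp add: hermitian_def Z3_def Y3_def smult_monom del: power_Suc)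
qed

lemma map_poly_mult_hom:
  fixes h :: "'a::comm_ring_1 \<Rightarrow> 'b::comm_ring_1"
  assumes "h 0 = 0" "\<And>x y. h (x + y) = h x + h y" "\<And>x y. h (x * y) = h x * h y"
  shows "map_poly h (p * q) = map_poly h p * map_poly h q"
proof -
  have "h (sum f A) = (\<Sum>i\<in>A. h (f i))" for f :: "nat \<Rightarrow> 'a" and A
    by (induction A rule: infinite_finite_induct) (simp_all add: assms)
  then show ?thesis
    by (intro poly_eqI) (simp add: coeff_map_poly coeff_mult assms)
qed

text \<open>Eisenstein's criterion with reversed coefficients: in \<open>K[X,Y][Z]\<close> the prime \<open>Y\<close> divides the
  leading coefficient \<open>Y\<close> exactly once and all others except the constant one \<open>-X^(N+1)\<close>.\<close>
lemma hermitian_factor_unit: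
  fixes A B :: "'k::field poly3"
  assumes N: "N \<ge> 2" and AB: "hermitian N = A * B" and Y: "\<not> [:0, 1:] dvd lead_coeff B"
  shows "B dvd 1"
proof -
  define h where "h = (\<lambda>p :: 'k poly poly. poly p 0)"
  have h: "h 0 = 0" "\<And>x y. h (x + y) = h x + h y" "\<And>x y. h (x * y) = h x * h y"
    by (simp_all add: h_def)
  \<comment> \<open>Modulo \<open>Y\<close> only \<open>-X^(N+1)\<close> survives, so both reduced
    factors are constant in \<open>Z\<close>.\<close>
  have hH: "map_poly h (hermitian N) = [:- ([:0, 1:] ^ (N + 1)):]"
    using N by (intro poly_eqI)
      (auto simp: coeff_map_poly h_def hermitian_expand coeff_pCons poly_power power_0_left split: nat.splits)
  have hAB: "map_poly h A * map_poly h B = [:- ([:0, 1:] ^ (N + 1)):]"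
    using hH AB map_poly_mult_hom[of h A B] h by simp
  have "degree (map_poly h A * map_poly h B) = degree (map_poly h A) + degree (map_poly h B)"
    using hAB by (intro degree_mult_eq) (auto simp del: mult_pCons_left mult_pCons_right)
  then have "degree (map_poly h B) = 0" unfolding hAB by simp
  moreover have "h (lead_coeff B) \<noteq> 0"
    using Y poly_eq_0_iff_dvd[of "lead_coeff B" 0] by (simp add: h_def)
  ultimately have "degree B = 0"
    by (metis coeff_map_poly h(1) le_degree le_zero_eq)
  then obtain u where u: "B = [:u:]" by (metis degree_eq_zeroE)
  have lead: "coeff (hermitian N) N = ([:0, 1:] :: 'k poly poly)"
    using N by (simp add: hermitian_expand coeff_pCons split: nat.splits)
  \<comment> \<open>The prime \<open>Y\<close> does not divide \<open>u\<close>, so it divides the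
    cofactor, which makes \<open>u\<close> a unit.\<close>
  have Yu: "[:0, 1:] = coeff A N * u"
    using lead unfolding AB u by (simp add: mult.commute)
  have "poly (coeff A N) 0 * poly u 0 = 0"
    using arg_cong[OF Yu, of "\<lambda>p. poly p 0"] by simp
  moreover have "poly u 0 \<noteq> 0"
    using Y u poly_eq_0_iff_dvd[of u 0] by simp
  ultimately have "[:0, 1:] dvd coeff A N"
    using poly_eq_0_iff_dvd[of "coeff A N" 0] by simp
  then obtain t where t: "coeff A N = [:0, 1:] * t" by (auto elim: dvdE)
  then have "[:0, 1:] * 1 = [:0, 1:] * (t * u)"
    using Yu t by (metis mult.assoc mult_1_right)
  then have "t * u = 1" by (simp only: mult_cancel_left) simp
  then have "[:t:] * B = 1" by (simp add: u one_pCons mult.commute)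
  then show ?thesis by (metis dvd_triv_right)
qed


lemma not_dvd_one_hermitian:
  "\<not> (hermitian N :: 'k::field poly3) dvd 1" if "N \<ge> 2"
proof
  assume "(hermitian N :: 'k poly3) dvd 1"
  then have "degree (hermitian N :: 'k poly3) = 0" by (auto simp: is_unit_poly_iff)
  moreover have "coeff (hermitian N) N = ([:0, 1:] :: 'k poly poly)"
    using that by (simp add: hermitian_expand coeff_pCons split: nat.splits)
  ultimately show False using that by (simp add: coeff_eq_0)
qed

text \<open>The leading coefficient in \<open>Z\<close> is the prime \<open>Y\<close>, which cannot
  divide both leading coefficients of a factorization; \<open>hermitian_factor_unit\<close> applies
  to a factor where it does not.\<close>

lemma irreducible_hermitian:
  assumes "N \<ge> 2"
  shows "irreducible (hermitian N :: 'k::field poly3)"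
proof (rule irreducibleI)
  have lead: "coeff (hermitian N) N = ([:0, 1:] :: 'k poly poly)"
    using assms by (simp add: hermitian_expand coeff_pCons split: nat.splits)
  then show nz: "(hermitian N :: 'k poly3) \<noteq> 0" by auto
  show "\<not> (hermitian N :: 'k poly3) dvd 1" using assms by (rule not_dvd_one_hermitian)
  fix A B :: "'k poly3" assume AB: "hermitian N = A * B"
  have "degree (hermitian N :: 'k poly3) \<le> N"
    using assms by (intro degree_le) (auto simp: hermitian_expand coeff_pCons split: nat.splits)
  then have "degree (hermitian N :: 'k poly3) = N"
    using lead by (intro antisym le_degree) auto
  then have "lead_coeff A * lead_coeff B = [:0, 1:]"
    using lead AB by (metis lead_coeff_mult)
  then have "\<not> ([:0, 1:] dvd lead_coeff A \<and> [:0, 1:] dvd lead_coeff B)"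
  proof -
    have False if "[:0, 1:] dvd lead_coeff A" "[:0, 1:] dvd lead_coeff B"
    proof -
      have "[:0, 1:] * [:0, 1:] dvd ([:0, 1:] * 1 :: 'k poly poly)"
        using mult_dvd_mono[OF that] \<open>lead_coeff A * lead_coeff B = [:0, 1:]\<close> by simp
      then have "([:0, 1:] :: 'k poly poly) dvd 1"
        by (subst (asm) dvd_mult_cancel_left) simp
      then show False by (simp add: is_unit_poly_iff)
    qed
    then show ?thesis by blast
  qed
  then show "A dvd 1 \<or> B dvd 1"
    using hermitian_factor_unit[OF assms AB] hermitian_factor_unit[OF assms, of B A] AB
    by (auto simp: mult.commute)
qed

section \<open>The projective unitary group\<close>

context closed_field_char
begin

lemma PGU3_I:
  fixes A :: "'k^3^3"
  assumes "det A \<noteq> 0" "\<And>i j. A $ i $ j \<in> Fq"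
    and "\<And>x y z. ev3 (hermitian n) (A $ 1 $ 1 * x + A $ 1 $ 2 * y + A $ 1 $ 3 * z)
      (A $ 2 $ 1 * x + A $ 2 $ 2 * y + A $ 2 $ 3 * z)
      (A $ 3 $ 1 * x + A $ 3 $ 2 * y + A $ 3 $ 3 * z) = ev3 (hermitian n) x y z"
  shows "A \<in> PGU3 n"
proof -
  have "subst3 (hermitian n) A = C3 1 * hermitian n"
    by (intro ev3_eqI[OF infinite_K]) (simp only: ev3_subst3 ev3_lin3 ev3_ring_simps assms(3) mult_1)
  then show ?thesis
    using assms(1,2) unfolding PGU3_def Fq_def by (auto simp: invertible_det_nz intro!: exI[of _ 1])
qed

lemma U_in_PGU3:
  assumes b: "b \<in> Fq" and c: "c + c ^ n = b ^ (n + 1)"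
  shows "(vector [vector [1, 0, b], vector [b ^ n, 1, c], vector [0, 0, 1]] :: 'k^3^3) \<in> PGU3 n"
    (is "?A \<in> _")
proof (rule PGU3_I)
  show "det ?A \<noteq> 0" by (simp add: det_3)
  have "\<forall>i j. ?A $ i $ j \<in> Fq"
    using b Fq_power[OF b] trace_norm_imp_in_Fq[OF b c] n_ge_2 one_in_Fq
    by (simp add: forall_3 Fq_def)
  then show "?A $ i $ j \<in> Fq" for i j by blast
  show "ev3 (hermitian n) (?A $ 1 $ 1 * x + ?A $ 1 $ 2 * y + ?A $ 1 $ 3 * z)
      (?A $ 2 $ 1 * x + ?A $ 2 $ 2 * y + ?A $ 2 $ 3 * z)
      (?A $ 3 $ 1 * x + ?A $ 3 $ 2 * y + ?A $ 3 $ 3 * z) = ev3 (hermitian n) x y z" for x y z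
    using U_invariantD[OF UL_invariant_hermitian b c, of x z y] by (simp add: add_ac)
qed

lemma L_in_PGU3:
  assumes b: "b \<in> Fq" and c: "c + c ^ n = b ^ (n + 1)"
  shows "(vector [vector [1, b, 0], vector [0, 1, 0], vector [b ^ n, c, 1]] :: 'k^3^3) \<in> PGU3 n"
    (is "?A \<in> _")
proof (rule PGU3_I)
  show "det ?A \<noteq> 0" by (simp add: det_3)
  have "\<forall>i j. ?A $ i $ j \<in> Fq"
    using b Fq_power[OF b] trace_norm_imp_in_Fq[OF b c] n_ge_2 one_in_Fq
    by (simp add: forall_3 Fq_def)
  then show "?A $ i $ j \<in> Fq" for i j by blast
  show "ev3 (hermitian n) (?A $ 1 $ 1 * x + ?A $ 1 $ 2 * y + ?A $ 1 $ 3 * z)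
      (?A $ 2 $ 1 * x + ?A $ 2 $ 2 * y + ?A $ 2 $ 3 * z)
      (?A $ 3 $ 1 * x + ?A $ 3 $ 2 * y + ?A $ 3 $ 3 * z) = ev3 (hermitian n) x y z" for x y z
    using L_invariantD[OF UL_invariant_hermitian b c, of x y z] by (simp add: add_ac)
qed

text \<open>A matrix preserving the curve may multiply \<open>F\<close> by a scalar
  \<open>e\<close>; for \<open>u(b,c)\<close> and \<open>l(b,c)\<close>,
  \<open>semi_invariant_multiplier_eq_1\<close> forces \<open>e = 1\<close>.\<close>

lemma UL_invariant_if_invariant3:
  fixes F :: "'k poly3"
  assumes inv: "invariant3 (PGU3 n) F" and "F \<noteq> 0"
  shows "UL_invariant (ev3 F)"
proof -
  obtain x0 y0 z0 where nz: "ev3 F x0 y0 z0 \<noteq> 0"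
    using ev3_eq_0_imp_0[OF infinite_K] assms(2) by blast
  have "ev3 F (x + b * z) (y + b ^ n * x + c * z) z = ev3 F x y z"
    if bc: "b \<in> Fq" "c + c ^ n = b ^ (n + 1)" for b c x y z
  proof -
    obtain e where e: "subst3 F (vector [vector [1, 0, b], vector [b ^ n, 1, c], vector [0, 0, 1]]) = C3 e * F"
      using inv U_in_PGU3[OF bc] unfolding invariant3_def by blast
    have *: "ev3 F (x + b * z) (y + b ^ n * x + c * z) z = e * ev3 F x y z" for x y z
      using arg_cong[OF e, of "\<lambda>G. ev3 G x y z"]
      by (simp add: ev3_subst3 ev3_lin3 add_ac)
    show ?thesis
      using * semi_invariant_multiplier_eq_1[of "ev3 F", OF * nz] by simp
  qed
  moreover have "ev3 F (x + b * y) y (z + b ^ n * x + c * y) = ev3 F x y z"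
    if bc: "b \<in> Fq" "c + c ^ n = b ^ (n + 1)" for b c x y z
  proof -
    obtain e where e: "subst3 F (vector [vector [1, b, 0], vector [0, 1, 0], vector [b ^ n, c, 1]]) = C3 e * F"
      using inv L_in_PGU3[OF bc] unfolding invariant3_def by blast
    have *: "ev3 F (x + b * y) y (z + b ^ n * x + c * y) = e * ev3 F x y z" for x y z
      using arg_cong[OF e, of "\<lambda>G. ev3 G x y z"]
      by (simp add: ev3_subst3 ev3_lin3 add_ac)
    show ?thesis
      using * semi_invariant_multiplier_eq_1[of "\<lambda>x y z. ev3 F x z y", OF * nz] by simp
  qed
  ultimately show ?thesis by (simp add: UL_invariant_def U_invariant_def)
qed

section \<open>The invariant curve of degree \<open>n^3 + 1\<close>\<close>

text \<open>Turns a pointwise identity into identities between matrix entries. Unit vectors kill the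
  diagonal; the vectors \<open>e_i + s e_j\<close> with \<open>s = 1\<close> and with some
  \<open>t ^ n\<close> different from \<open>t\<close> kill the rest.\<close>

lemma sesquilinear_form_eq_0:
  fixes M :: "3 \<Rightarrow> 3 \<Rightarrow> 'k"
  assumes M: "\<And>v. (\<Sum>i\<in>UNIV. \<Sum>j\<in>UNIV. M i j * v i * v j ^ n) = 0"
  shows "M i j = 0"
proof -
  have n0: "n \<noteq> 0" using n_ge_2 by simp
  have diag: "M i i = 0" for i
    using M[of "\<lambda>k. if k = i then 1 else 0"] exhaust_3[of i] n0
    by (auto simp: sum_3 power_0_left)
  have "coeff (monom 1 n - [:0, 1:] :: 'k poly) 1 \<noteq> 0"
    using n_ge_2 by simp
  then have "monom 1 n - [:0, 1:] \<noteq> (0 :: 'k poly)" by fastforce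
  then obtain t :: 'k where "poly (monom 1 n - [:0, 1:]) t \<noteq> 0"
    using poly_eq_0_if_infinite_roots[OF infinite_K] by blast
  then have t: "t ^ n \<noteq> t" by (simp add: poly_monom)
  have pair: "M i j * s ^ n + M j i * s = 0" if "i \<noteq> j" for i j s
    using M[of "\<lambda>k. if k = i then 1 else if k = j then s else 0"] exhaust_3[of i] exhaust_3[of j] n0 that
      diag[of 1] diag[of 2] diag[of 3]
    by (auto simp: sum_3 power_0_left add_ac)
  show ?thesis
  proof (cases "i = j")
    case False
    have "M j i = - M i j" using pair[OF False, of 1] by (simp add: add_eq_0_iff)
    then have "M i j * (t ^ n - t) = 0" using pair[OF False, of t] by (simp add: algebra_simps)
    then show ?thesis using t by simp
  qed (simp add: diag)
qed

lemma frob3_add: "(x + y :: 'k) ^ n ^ 3 = x ^ n ^ 3 + y ^ n ^ 3"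
  by (simp add: power3_eq_cube power_mult frob_add)

text \<open>Both Hermitian forms specialise one bilinear expression in \<open>v\<close> and
  \<open>w\<close>, at \<open>w = v^n\<close> and at \<open>w = v^(n^3)\<close>. As the two powers
  agree on the entries of \<open>A\<close>, the action of \<open>A\<close> on \<open>w\<close> is
  the same in both cases.\<close>

lemma invariant3_hermitian_cube: "invariant3 (PGU3 n) (hermitian (n ^ 3) :: 'k poly3)"
  unfolding invariant3_def
proof
  fix A :: "'k^3^3" assume A: "A \<in> PGU3 n"
  then obtain c where c: "c \<noteq> 0" "subst3 (hermitian n) A = C3 c * hermitian n"
    unfolding PGU3_def by blast
  have a3: "(A $ i $ j) ^ n ^ 3 = (A $ i $ j) ^ n" for i j
  proof -
    have "n ^ 3 = n\<^sup>2 * n" by (simp add: power2_eq_square power3_eq_cube)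
    moreover have "(A $ i $ j) ^ n\<^sup>2 = A $ i $ j" using A unfolding PGU3_def by blast
    ultimately show ?thesis by (metis power_mult)
  qed
  \<comment> \<open>The transformed bilinear form minus \<open>c\<close> times the original
    one.\<close>
  define M :: "3 \<Rightarrow> 3 \<Rightarrow> 'k" where "M i j = A $ 2 $ i * (A $ 3 $ j) ^ n + A $ 3 $ i * (A $ 2 $ j) ^ n
    - A $ 1 $ i * (A $ 1 $ j) ^ n
    - c * (if i = 2 \<and> j = 3 \<or> i = 3 \<and> j = 2 then 1 else if i = 1 \<and> j = 1 then -1 else 0)" for i j
  define row where "row i v = A $ i $ 1 * v 1 + A $ i $ 2 * v 2 + A $ i $ 3 * v 3" for i and v :: "3 \<Rightarrow> 'k"
  define row' where "row' i w = (A $ i $ 1) ^ n * w 1 + (A $ i $ 2) ^ n * w 2 + (A $ i $ 3) ^ n * w 3" for i and w :: "3 \<Rightarrow> 'k"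
  \<comment> \<open>\<open>w\<close> stays independent of \<open>v\<close> so that it can be
    specialised twice.\<close>
  have form: "(\<Sum>i\<in>UNIV. \<Sum>j\<in>UNIV. M i j * v i * w j) =
     row' 2 w * row 3 v + row 2 v * row' 3 w - row 1 v * row' 1 w
      - c * (w 2 * v 3 + v 2 * w 3 - v 1 * w 1)" for v w
    by (simp add: sum_3 M_def row_def row'_def algebra_simps)
  have "(\<Sum>i\<in>UNIV. \<Sum>j\<in>UNIV. M i j * v i * v j ^ n) = 0" for v
  proof -
    have "row i v ^ n = row' i (\<lambda>j. v j ^ n)" for i
      by (simp add: row_def row'_def frob_add power_mult_distrib)
    then show ?thesis
      unfolding form[of v "\<lambda>j. v j ^ n"]
      using arg_cong[OF c(2), of "\<lambda>G. ev3 G (v 1) (v 2) (v 3)"]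
      by (simp add: ev3_subst3 ev3_lin3 ev3_hermitian flip: row_def)
  qed
  then have M0: "M i j = 0" for i j by (rule sesquilinear_form_eq_0)
  have "subst3 (hermitian (n ^ 3)) A = C3 c * hermitian (n ^ 3)"
  proof (rule ev3_eqI[OF infinite_K])
    fix x y z
    define v :: "3 \<Rightarrow> 'k" where "v = (\<lambda>i. if i = 1 then x else if i = 2 then y else z)"
    have v: "v 1 = x" "v 2 = y" "v 3 = z" by (simp_all add: v_def)
    have "row i v ^ n ^ 3 = row' i (\<lambda>j. v j ^ n ^ 3)" for i
      by (simp add: row_def row'_def frob3_add power_mult_distrib a3)
    then show "ev3 (subst3 (hermitian (n ^ 3)) A) x y z = ev3 (C3 c * hermitian (n ^ 3)) x y z"
      using form[of v "\<lambda>j. v j ^ n ^ 3"]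
      by (simp add: M0 ev3_subst3 ev3_lin3 ev3_hermitian flip: row_def v)
  qed
  then show "\<exists>c. c \<noteq> 0 \<and> subst3 (hermitian (n ^ 3)) A = C3 c * hermitian (n ^ 3)"
    using c(1) by blast
qed

section \<open>Degrees of the invariant irreducible curves\<close>

lemma inv_irr_curve_hermitian: "inv_irr_curve_deg (PGU3 n) (n + 1) (hermitian n :: 'k poly3)"
  using irreducible_hermitian[OF n_ge_2] homogeneous3_hermitian
  unfolding inv_irr_curve_deg_def invariant3_def PGU3_def by auto

lemma inv_irr_curve_hermitian_cube:
  "inv_irr_curve_deg (PGU3 n) (n ^ 3 + 1) (hermitian (n ^ 3) :: 'k poly3)"
proof -
  have "n ^ 3 \<ge> 2" using n_ge_2 power_mono[OF n_ge_2, of 3] by simp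
  then have "irreducible (hermitian (n ^ 3) :: 'k poly3)" by (rule irreducible_hermitian)
  then show ?thesis
    using homogeneous3_hermitian invariant3_hermitian_cube
    unfolding inv_irr_curve_deg_def by auto
qed

text \<open>\<open>F\<close> is a scalar times a power of the Hermitian form, and irreducibility
  leaves only the first power. This yields the minimal degree, the uniqueness and the gap up to
  \<open>n^3\<close> at once.\<close>

lemma inv_irr_curve_low_degree:
  fixes F :: "'k poly3"
  assumes F: "inv_irr_curve_deg (PGU3 n) d F" and d: "d \<le> n ^ 3"
  shows "d = n + 1 \<and> (\<exists>c. c \<noteq> 0 \<and> F = C3 c * hermitian n)"
proof -
  have F': "F \<noteq> 0" "homogeneous3 d F" "irreducible F" "invariant3 (PGU3 n) F"
    using F by (auto simp: inv_irr_curve_deg_def)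
  obtain c k where ck: "c \<noteq> 0" "F = C3 c * hermitian n ^ k" "d = (n + 1) * k"
    using invariant_form_eq_hermitian_power[OF F'(2) d UL_invariant_if_invariant3[OF F'(4,1)] F'(1)] .
  have unit: "C3 c dvd (1 :: 'k poly3)"
  proof -
    have "C3 c * C3 (1 / c) = (1 :: 'k poly3)" using ck(1) by (simp add: C3_def one_pCons)
    then show ?thesis by (metis dvd_triv_left)
  qed
  have "k \<noteq> 0"
  proof
    assume "k = 0"
    then have "F dvd 1" using unit ck(2) by simp
    then show False using F'(3) by (simp add: irreducible_not_unit)
  qed
  moreover have "\<not> k \<ge> 2"
  proof
    assume "k \<ge> 2"
    then obtain m where m: "k = Suc (Suc m)" by (metis add_2_eq_Suc le_Suc_ex)
    have "F = (C3 c * hermitian n ^ Suc m) * hermitian n"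
      by (simp add: ck(2) m ac_simps)
    then have "C3 c * hermitian n ^ Suc m dvd (1 :: 'k poly3) \<or> hermitian n dvd (1 :: 'k poly3)"
      using F'(3) irreducibleD by blast
    then have "hermitian n dvd (1 :: 'k poly3)"
      by (metis dvd_mult_left dvd_mult_right power_Suc)
    then show False using not_dvd_one_hermitian[OF n_ge_2] by blast
  qed
  ultimately have "k = 1" by linarith
  then show ?thesis using ck by auto
qed

end

theorem mainTheorem10:
  fixes p n q :: nat
  assumes "prime p"
    and "\<exists>m\<ge>1. n = p ^ m"
    and "q = n ^ 2"
    and "CHAR('k::field) = p"
    and "\<forall>f :: 'k poly. degree f \<ge> 1 \<longrightarrow> (\<exists>x. poly f x = 0)"
    and "\<forall>x :: 'k. \<exists>k\<ge>1. x ^ (p ^ k) = x"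
  shows "d_inv (PGU3 n :: ('k^3^3) set) = n + 1
       \<and> eps_inv (PGU3 n :: ('k^3^3) set) = q * n - n
       \<and> (\<forall>F :: 'k poly3. inv_irr_curve_deg (PGU3 n) (n + 1) F
            \<longrightarrow> (\<exists>c. c \<noteq> 0 \<and> F = C3 c * hermitian n))"
proof -
  interpret closed_field_char p n "TYPE('k)"
    using assms by unfold_locales auto
  \<comment> \<open>This puts degree \<open>n + 1\<close> in the range of
    \<open>inv_irr_curve_low_degree\<close>.\<close>
  have "n + 1 \<le> 2 * 2 * n"
    using n_ge_2 by simp
  also have "\<dots> \<le> n * n * n"
    using n_ge_2 by (intro mult_le_mono) auto
  finally have n3: "n + 1 \<le> n ^ 3"
    by (simp add: power3_eq_cube)
  have d: "d_inv (PGU3 n :: ('k^3^3) set) = n + 1"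
    unfolding d_inv_def
  proof (rule Least_equality)
    show "2 \<le> n + 1 \<and> (\<exists>F :: 'k poly3. inv_irr_curve_deg (PGU3 n) (n + 1) F)"
      using n_ge_2 inv_irr_curve_hermitian by auto
    show "n + 1 \<le> d" if "2 \<le> d \<and> (\<exists>F :: 'k poly3. inv_irr_curve_deg (PGU3 n) d F)" for d
      using that inv_irr_curve_low_degree n3 by (metis le_refl nle_le order_trans)
  qed
  have d': "d'_inv (PGU3 n :: ('k^3^3) set) = n ^ 3 + 1"
    unfolding d'_inv_def d
  proof (rule Least_equality)
    show "n + 1 < n ^ 3 + 1 \<and> (\<exists>F :: 'k poly3. inv_irr_curve_deg (PGU3 n) (n ^ 3 + 1) F)"
      using n3 inv_irr_curve_hermitian_cube by auto
    show "n ^ 3 + 1 \<le> e" if "n + 1 < e \<and> (\<exists>F :: 'k poly3. inv_irr_curve_deg (PGU3 n) e F)" for e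
      using that inv_irr_curve_low_degree by (metis Suc_eq_plus1 less_irrefl not_less_eq_eq)
  qed
  \<comment> \<open>Both sides equal \<open>n^3 - n\<close>.\<close>
  have "eps_inv (PGU3 n :: ('k^3^3) set) = q * n - n"
    unfolding eps_inv_def d d' assms(3) by (simp add: power2_eq_square power3_eq_cube)
  then show ?thesis
    using d inv_irr_curve_low_degree n3 by blast
qed

end
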